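(* Let $d\in\mathbb{N}$, let $N\ge 0$ be an integer, let $\omega$ be an admissible radial measure on $\mathbb{B}_d$, and let $f\in B^N_\omega$ extend continuously to $\overline{\mathbb{B}}_d$. If $\operatorname{Cap}_\alpha(Z_{\partial}(f))>0$ for some $\alpha>0$, then $f$ is not cyclic in $B^N_\omega$.
   Context: $\mathbb{B}_d$ is the open unit ball of $\mathbb{C}^d$. A measure $\omega$ on $\mathbb{B}_d$ is an admissible radial measure if it has the form $d\omega(z)=d\mu(r)\,d\sigma(w)$, $z=rw$, $0\le r<1$, $w\in\partial\mathbb{B}_d$, where $\sigma$ is the normalized rotation-invariant measure on $\partial\mathbb{B}_d$ and $\mu$ is a Borel measure on $[0,1]$ with $\mu((r,1])>0$ for all $0<r<1$. With the radial derivative $R=\sum_{j=1}^d z_j\frac{\partial}{\partial z_j}$, the radially weighted Besov space is $B^N_\omega=\{f\in\operatorname{Hol}(\mathbb{B}_d): R^Nf\in L^2(\omega)\}$, with norm $\|f\|_{B^N_\omega}^2=\|f\|_{L^2(\omega)}^2$ if $N=0$ and $\|f\|_{B^N_\omega}^2=\omega(\mathbb{B}_d)|f(0)|^2+\|R^Nf\|_{L^2(\omega)}^2$ if $N>0$. For $H=B^N_\omega$, the multiplier algebra is $\operatorname{Mult}(H)=\{\varphi:\varphi h\in H\text{ for all }h\in H\}$ (functions $\varphi$ on $\mathbb{B}_d$). For $f\in H$, $[f]=\overline{\{\varphi f:\varphi\in\operatorname{Mult}(H)\}}$, with closure in the norm of $H$; $f$ is cyclic in $H$ if $[f]=H$.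 The boundary zero set of $f$ is $Z_{\partial}(f)=\{z\in\partial\mathbb{B}_d: f(z)=0\}$. Its $\alpha$-capacity is $$\operatorname{Cap}_\alpha(Z_{\partial}(f))=\inf\left\{\int_{\partial\mathbb{B}_d}g^\alpha\,d\sigma:\ g\in C(\partial\mathbb{B}_d),\ g\ge 0,\ g\ge 1\text{ on }Z_{\partial}(f)\right\}.$$
   Formalization: The measure μ is assumed finite (for infinite μ, N=0, the space can be {0} and f=0 is cyclic), and a mass of μ at r=1 contributes the usual Hardy-space term to the L²(ω) norm and to the total mass instead of being ignored (for μ=δ_1 the literal norm is 0). *)

theory Defs
  imports "HOL-Analysis.Analysis"
begin

definition holomorphic_Cd :: "(complex^'d \<Rightarrow> complex) \<Rightarrow> (complex^'d) set \<Rightarrow> bool" where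
  "holomorphic_Cd f S \<longleftrightarrow>
     (\<forall>z\<in>S. \<exists>D. (f has_derivative D) (at z) \<and> (\<forall>c v. D (c *s v) = c * D v))"

definition radial_deriv :: "(complex^'d \<Rightarrow> complex) \<Rightarrow> complex^'d \<Rightarrow> complex" where
  "radial_deriv f z = (\<Sum>j\<in>UNIV. z $ j * deriv (\<lambda>t. f (z + t *s axis j 1)) 0)"

text \<open>The library has no surface measure on spheres.  The normalized rotation-invariant measure
  is obtained as the image of the uniform distribution on the ball under radial projection;
  normalization and rotation invariance are proved below.\<close>

definition sphere_measure :: "(complex^'d) measure" where
  "sphere_measure =
     restrict_space (distr (uniform_measure lborel (ball 0 1)) borel sgn) (sphere 0 1)"

lemma space_sphere_measure [simp]: "space sphere_measure = sphere 0 1"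
  by (simp add: sphere_measure_def space_restrict_space)

lemma sets_sphere_measure [measurable_cong]:
  "sets sphere_measure = sets (restrict_space borel (sphere 0 1))"
  by (simp add: sphere_measure_def sets_restrict_space)

lemma measurable_sgn_borel [measurable]:
  "(sgn :: 'a::euclidean_space \<Rightarrow> 'a) \<in> borel_measurable borel"
  unfolding sgn_div_norm by measurable

lemma emeasure_sphere_measure:
  fixes A :: "(complex^'d) set"
  assumes "A \<in> sets borel" "A \<subseteq> sphere 0 1"
  shows "emeasure sphere_measure A =
    emeasure lborel (ball 0 1 \<inter> sgn -` A) / emeasure lborel (ball (0::complex^'d) 1)"
proof -
  have "sgn -` A \<in> sets (borel :: (complex^'d) measure)"
    using measurable_sets[OF measurable_sgn_borel assms(1)] by simp
  then show ?thesis
    using assms by (simp add: sphere_measure_def emeasure_restrict_space emeasure_distr)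
qed

lemma emeasure_sphere_measure_space: "emeasure sphere_measure (sphere (0::complex^'d) 1) = 1"
proof -
  have eq: "ball 0 1 \<inter> sgn -` sphere 0 1 = ball 0 1 - {0::complex^'d}"
    by (auto simp: norm_sgn)
  have "emeasure lborel (ball 0 1 - {0::complex^'d}) = emeasure lborel (ball (0::complex^'d) 1)"
    by (subst emeasure_Diff) (auto simp: emeasure_lborel_singleton)
  moreover have "emeasure lborel (ball (0::complex^'d) 1) \<noteq> 0"
    using emeasure_ball[of 1 "0::complex^'d"]
      less_imp_neq[OF unit_ball_vol_pos[of "real DIM(complex^'d)"], symmetric] by simp
  moreover have "emeasure lborel (ball (0::complex^'d) 1) \<noteq> \<infinity>"
    using emeasure_lborel_ball_finite[of "0::complex^'d" 1] by simp
  ultimately show ?thesis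
    by (simp add: emeasure_sphere_measure eq ennreal_divide_self less_top)
qed

lemma emeasure_lborel_orthogonal_vimage:
  fixes T :: "'a::euclidean_space \<Rightarrow> 'a"
  assumes T: "orthogonal_transformation T" and A: "A \<in> sets borel"
  shows "emeasure lborel (T -` A) = emeasure lborel A"
proof -
  have lin: "linear T" using T by (rule orthogonal_transformation_linear)
  have T_m [measurable]: "T \<in> borel_measurable borel"
    using lin linear_continuous_on borel_measurable_continuous_onI linear_conv_bounded_linear by blast
  note A [measurable]
  define B :: "'a set" where "B = ball 0 1"
  have B [measurable]: "B \<in> sets borel" by (simp add: B_def)
  have shift: "(\<integral>\<^sup>+ x. h (x + c) \<partial>lborel) = (\<integral>\<^sup>+ x. h x \<partial>lborel)"
    if [measurable]: "h \<in> borel_measurable borel" for h :: "'a \<Rightarrow> ennreal" and c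
  proof -
    have "(\<integral>\<^sup>+ x. h x \<partial>lborel) = (\<integral>\<^sup>+ x. h x \<partial>distr lborel borel ((+) c))"
      by (simp add: lborel_distr_plus)
    also have "\<dots> = (\<integral>\<^sup>+ x. h (x + c) \<partial>lborel)"
      by (subst nn_integral_distr) (auto simp: add.commute)
    finally show ?thesis by simp
  qed
  have vT: "T -` A \<in> sets borel" using measurable_sets[OF T_m A] by simp
  have "emeasure lborel (T -` A) * emeasure lborel B
      = (\<integral>\<^sup>+ y. (\<integral>\<^sup>+ x. indicator A (T x) \<partial>lborel) * indicator B y \<partial>lborel)"
  proof -
    have "(\<integral>\<^sup>+ x. indicator A (T x) \<partial>lborel) = (\<integral>\<^sup>+ x. indicator (T -` A) x \<partial>lborel)"
      by (simp add: indicator_def)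
    then show ?thesis using vT by (simp add: nn_integral_cmult)
  qed
  also have "\<dots> = (\<integral>\<^sup>+ y. (\<integral>\<^sup>+ x. indicator A (T x + y) \<partial>lborel) * indicator B y \<partial>lborel)"
  proof (rule nn_integral_cong)
    fix y :: 'a
    obtain c where c: "T c = y"
      using orthogonal_transformation_surj[OF T] by (metis surjD)
    have "(\<integral>\<^sup>+ x. indicator A (T x) \<partial>lborel) = (\<integral>\<^sup>+ x. (indicator A (T (x + c)) :: ennreal) \<partial>lborel)"
      by (rule shift[symmetric]) measurable
    then show "(\<integral>\<^sup>+ x. indicator A (T x) \<partial>lborel) * indicator B y
      = (\<integral>\<^sup>+ x. indicator A (T x + y) \<partial>lborel) * indicator B y"
      by (simp add: linear_add[OF lin] c)
  qed
  also have "\<dots> = (\<integral>\<^sup>+ y. (\<integral>\<^sup>+ x. indicator A (T x + y) * indicator B y \<partial>lborel) \<partial>lborel)"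
    by (intro nn_integral_cong nn_integral_multc[symmetric]) measurable
  also have "\<dots> = (\<integral>\<^sup>+ x. (\<integral>\<^sup>+ y. indicator A (T x + y) * indicator B y \<partial>lborel) \<partial>lborel)"
    by (rule lborel_pair.Fubini') measurable
  also have "\<dots> = (\<integral>\<^sup>+ x. (\<integral>\<^sup>+ y. indicator A y * indicator B (y - T x) \<partial>lborel) \<partial>lborel)"
  proof (rule nn_integral_cong)
    fix x
    have [measurable]: "(\<lambda>y. indicator A y * indicator B (y - T x) :: ennreal) \<in> borel_measurable borel"
      by measurable
    show "(\<integral>\<^sup>+ y. indicator A (T x + y) * indicator B y \<partial>lborel)
      = (\<integral>\<^sup>+ y. (indicator A y * indicator B (y - T x) :: ennreal) \<partial>lborel)"
      using shift[of "\<lambda>y. indicator A y * indicator B (y - T x)" "T x"]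
      by (simp add: add.commute)
  qed
  also have "\<dots> = (\<integral>\<^sup>+ y. (\<integral>\<^sup>+ x. indicator A y * indicator B (y - T x) \<partial>lborel) \<partial>lborel)"
    by (rule lborel_pair.Fubini') measurable
  also have "\<dots> = (\<integral>\<^sup>+ y. indicator A y * emeasure lborel B \<partial>lborel)"
  proof (rule nn_integral_cong)
    fix y :: 'a
    obtain c where c: "T c = y"
      using orthogonal_transformation_surj[OF T] by (metis surjD)
    have "norm (y - T x) = norm (c - x)" for x
      using orthogonal_transformation_norm[OF T, of "c - x"] by (simp add: linear_diff[OF lin] c)
    then have "indicator B (y - T x) = (indicator (ball c 1) x :: ennreal)" for x
      by (simp add: B_def indicator_def dist_norm norm_minus_commute[of "T x" y])
    moreover have "emeasure lborel (ball c 1) = emeasure lborel B"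
      by (simp add: B_def emeasure_ball)
    ultimately show "(\<integral>\<^sup>+ x. indicator A y * indicator B (y - T x) \<partial>lborel)
      = indicator A y * emeasure lborel B"
      by (simp add: nn_integral_cmult_indicator)
  qed
  also have "\<dots> = emeasure lborel A * emeasure lborel B"
    by (simp add: nn_integral_multc)
  finally have *: "emeasure lborel (T -` A) * emeasure lborel B = emeasure lborel A * emeasure lborel B" .
  have "emeasure lborel B \<noteq> 0"
    using emeasure_ball[of 1 "0::'a"] less_imp_neq[OF unit_ball_vol_pos[of "real DIM('a)"], symmetric]
    by (simp add: B_def)
  moreover have "emeasure lborel B < \<infinity>"
    using emeasure_lborel_ball_finite[of "0::'a" 1] by (simp add: B_def)
  ultimately show ?thesis
    using * by (metis ennreal_mult_divide_eq infinity_ennreal_def order_less_irrefl)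
qed

lemma sphere_measure_rotation_invariant:
  fixes T :: "complex^'d \<Rightarrow> complex^'d"
  assumes T: "orthogonal_transformation T" and A: "A \<in> sets sphere_measure"
  shows "T -` A \<in> sets sphere_measure"
    and "emeasure sphere_measure (T -` A) = emeasure sphere_measure A"
proof -
  have lin: "linear T" using T by (rule orthogonal_transformation_linear)
  have T_m [measurable]: "T \<in> borel_measurable borel"
    using lin linear_continuous_on borel_measurable_continuous_onI linear_conv_bounded_linear by blast
  have A': "A \<in> sets borel" "A \<subseteq> sphere 0 1"
    using A by (auto simp: sets_sphere_measure sets_restrict_space)
  have vT: "T -` A \<in> sets borel" using measurable_sets[OF T_m A'(1)] by simp
  have sub: "T -` A \<subseteq> sphere 0 1"
    using A'(2) orthogonal_transformation_norm[OF T] by auto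
  show "T -` A \<in> sets sphere_measure"
    using vT sub by (auto simp: sets_sphere_measure sets_restrict_space)
  have sgnT: "sgn (T z) = T (sgn z)" for z
    by (simp add: sgn_div_norm orthogonal_transformation_norm[OF T] linear_scale[OF lin])
  have "ball 0 1 \<inter> sgn -` (T -` A) = T -` (ball 0 1 \<inter> sgn -` A)"
    using orthogonal_transformation_norm[OF T] by (auto simp: sgnT)
  moreover have "sgn -` A \<in> sets (borel :: (complex^'d) measure)"
    using measurable_sets[OF measurable_sgn_borel A'(1)] by simp
  ultimately show "emeasure sphere_measure (T -` A) = emeasure sphere_measure A"
    using emeasure_lborel_orthogonal_vimage[OF T, of "ball 0 1 \<inter> sgn -` A"]
    by (simp add: emeasure_sphere_measure A' vT sub)
qed

text \<open>As \<open>\<omega>(\<B>\<^sub>d)\<close> enters the norm, \<open>\<mu>\<close> has to be finite.  An atom of \<open>\<mu>\<close> at 1 is admitted, since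
  the condition on \<open>\<mu>\<close> involves the closed endpoint; then \<open>\<omega>\<close> has mass on the sphere.\<close>

definition admissible_radial_measure :: "(complex^'d) measure \<Rightarrow> bool" where
  "admissible_radial_measure \<omega> \<longleftrightarrow>
     (\<exists>\<mu>::real measure. sets \<mu> = sets (restrict_space borel {0..1}) \<and> finite_measure \<mu> \<and>
        (\<forall>r. 0 < r \<and> r < 1 \<longrightarrow> emeasure \<mu> {r<..1} > 0) \<and>
        \<omega> = distr (\<mu> \<Otimes>\<^sub>M sphere_measure) borel (\<lambda>(r, w). r *\<^sub>R w))"

text \<open>The squared \<open>L\<^sup>2(\<omega>)\<close>-norm of a function \<open>g\<close> holomorphic in the ball.  The second summand
  vanishes if \<open>\<omega>\<close> is carried by the open ball.  Otherwise it is the Hardy space norm of \<open>g\<close>,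
  weighted by the mass of the sphere; the supremum over \<open>s\<close> is the limit as \<open>s\<close> tends to 1.\<close>

definition L2_norm_sq :: "(complex^'d) measure \<Rightarrow> (complex^'d \<Rightarrow> complex) \<Rightarrow> ennreal" where
  "L2_norm_sq \<omega> g =
     (\<integral>\<^sup>+z\<in>ball 0 1. ennreal ((norm (g z))\<^sup>2) \<partial>\<omega>) +
     (SUP s\<in>{0<..<1}. \<integral>\<^sup>+z\<in>sphere 0 1. ennreal ((norm (g (s *\<^sub>R z)))\<^sup>2) \<partial>\<omega>)"

lemma L2_norm_sq_open_ball:
  fixes g :: "complex^'d \<Rightarrow> complex"
  assumes "sets \<omega> = sets borel" "emeasure \<omega> (sphere 0 1) = 0"
  shows "L2_norm_sq \<omega> g = (\<integral>\<^sup>+z\<in>ball 0 1. ennreal ((norm (g z))\<^sup>2) \<partial>\<omega>)"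
proof -
  have null: "sphere 0 1 \<in> null_sets \<omega>"
    using assms by (auto simp: null_sets_def)
  have "(\<integral>\<^sup>+z\<in>sphere 0 1. h z \<partial>\<omega>) = 0" for h :: "complex^'d \<Rightarrow> ennreal"
    using nn_integral_null_set[OF null] by simp
  then show ?thesis
    by (simp add: L2_norm_sq_def)
qed

text \<open>Functions on the ball are represented by total functions; their values outside the ball
  do not matter for \<open>besov_space\<close> and \<open>besov_norm\<close>.  The total mass of \<open>\<omega>\<close> is its mass on the closed
  ball, which is \<open>\<omega>(\<B>\<^sub>d)\<close> unless \<open>\<omega>\<close> charges the sphere.\<close>

definition besov_space :: "nat \<Rightarrow> (complex^'d) measure \<Rightarrow> (complex^'d \<Rightarrow> complex) set" where
  "besov_space N \<omega> =
     {f. holomorphic_Cd f (ball 0 1) \<and> L2_norm_sq \<omega> ((radial_deriv ^^ N) f) < \<infinity>}"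

definition besov_norm :: "nat \<Rightarrow> (complex^'d) measure \<Rightarrow> (complex^'d \<Rightarrow> complex) \<Rightarrow> real" where
  "besov_norm N \<omega> f =
     (if N = 0 then sqrt (enn2real (L2_norm_sq \<omega> f))
      else sqrt (measure \<omega> (cball 0 1) * (norm (f 0))\<^sup>2
             + enn2real (L2_norm_sq \<omega> ((radial_deriv ^^ N) f))))"

definition multiplier_algebra :: "(complex^'d \<Rightarrow> complex) set \<Rightarrow> (complex^'d \<Rightarrow> complex) set" where
  "multiplier_algebra H = {\<phi>. \<forall>h\<in>H. (\<lambda>z. \<phi> z * h z) \<in> H}"

definition generated_subspace ::
  "(complex^'d \<Rightarrow> complex) set \<Rightarrow> ((complex^'d \<Rightarrow> complex) \<Rightarrow> real) \<Rightarrow>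
   (complex^'d \<Rightarrow> complex) \<Rightarrow> (complex^'d \<Rightarrow> complex) set" where
  "generated_subspace H nrm f =
     {h \<in> H. \<forall>\<epsilon>>0. \<exists>\<phi>\<in>multiplier_algebra H. nrm (\<lambda>z. \<phi> z * f z - h z) < \<epsilon>}"

definition cyclic_in_besov ::
  "nat \<Rightarrow> (complex^'d) measure \<Rightarrow> (complex^'d \<Rightarrow> complex) \<Rightarrow> bool" where
  "cyclic_in_besov N \<omega> f \<longleftrightarrow>
     generated_subspace (besov_space N \<omega>) (besov_norm N \<omega>) f = besov_space N \<omega>"

definition boundary_zero_set :: "(complex^'d \<Rightarrow> complex) \<Rightarrow> (complex^'d) set" where
  "boundary_zero_set F = {z \<in> sphere 0 1. F z = 0}"

definition capacity :: "real \<Rightarrow> (complex^'d) set \<Rightarrow> real" where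
  "capacity \<alpha> E =
     Inf {\<integral>w. g w powr \<alpha> \<partial>sphere_measure | g::complex^'d \<Rightarrow> real.
            continuous_on (sphere 0 1) g \<and> (\<forall>w\<in>sphere 0 1. g w \<ge> 0) \<and> (\<forall>w\<in>E. g w \<ge> 1)}"

end

theory Submission
  imports Defs "HOL-Complex_Analysis.Complex_Analysis"
begin

text \<open>Testing the capacity with \<open>max 0 (1 - n dist(w, E))\<close> shows that it is at most \<open>\<sigma>(E)\<close> for closed
  \<open>E\<close>, so the boundary zero set has positive surface measure.  By rotation invariance and Fubini, the
  slices \<open>\<lambda> \<mapsto> f(\<lambda>x)\<close> vanish on a set of positive measure of the unit circle for a nonnull set of
  \<open>x\<close>; the boundary uniqueness theorem in the disc makes \<open>f(x) = 0\<close> for these \<open>x\<close>.  A holomorphic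
  function vanishing on a nonnull subset of the ball is zero, and \<open>0\<close> does not generate the
  constant function \<open>1\<close>.\<close>

section \<open>Real parts of polynomials on the unit circle\<close>

text \<open>Peel off the constant terms \<open>a\<close> and \<open>b\<close> of both polynomials.
  As \<open>z * cnj z = 1\<close> on the circle, the product of the remainders loses its factor
  \<open>z\<close> and falls to the induction hypothesis; the term \<open>a * cnj (poly Q z)\<close>
  may be conjugated under \<open>Re\<close>.\<close>

lemma Re_poly_mult_cnj_on_circle:
  "\<exists>S. \<forall>z\<in>sphere 0 1. Re (poly P z * cnj (poly Q z)) = Re (poly S z)"
proof (induction P arbitrary: Q)
  case 0
  have "\<forall>z\<in>sphere 0 1. Re (poly 0 z * cnj (poly Q z)) = Re (poly 0 z)"
    by simp
  then show ?case by blast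
next
  case (pCons a P)
  obtain b Q' where Q: "Q = pCons b Q'" by (cases Q)
  obtain S where S: "\<And>z. z \<in> sphere 0 1 \<Longrightarrow> Re (poly P z * cnj (poly Q' z)) = Re (poly S z)"
    using pCons.IH[of Q'] by blast
  have "Re (poly (pCons a P) z * cnj (poly Q z))
      = Re (poly (smult (cnj a) Q + smult (cnj b) (pCons 0 P) + S) z)" if z: "z \<in> sphere 0 1" for z
  proof -
    have zz: "z * cnj z = 1"
      using z by (simp add: complex_norm_square[symmetric])
    have "poly (pCons a P) z * cnj (poly Q z)
        = a * cnj (poly Q z) + z * poly P z * cnj b + (z * cnj z) * (poly P z * cnj (poly Q' z))"
      by (simp add: Q algebra_simps)
    moreover have "Re (a * cnj (poly Q z)) = Re (cnj a * poly Q z)"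
      by simp
    ultimately show ?thesis
      using S[OF z] by (simp add: zz mult.commute) (simp add: algebra_simps)
  qed
  then show ?case by blast
qed

text \<open>From \<open>2 * Re p * Re q = Re (p * q) + Re (p * cnj q)\<close>, where the second
  summand is handled by the previous lemma.\<close>

lemma Re_poly_mult_on_circle:
  "\<exists>S. \<forall>z\<in>sphere 0 1. Re (poly P z) * Re (poly Q z) = Re (poly S z)"
proof -
  obtain S where S: "\<And>z. z \<in> sphere 0 1 \<Longrightarrow> Re (poly P z * cnj (poly Q z)) = Re (poly S z)"
    using Re_poly_mult_cnj_on_circle by blast
  have "Re (poly P z) * Re (poly Q z) = Re (poly (smult (1/2) (P * Q + S)) z)"
    if "z \<in> sphere 0 1" for z
    using S[OF that] by (simp add: field_simps)
  then show ?thesis by blast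
qed

text \<open>Stone-Weierstrass for the algebra of real parts of polynomials; closure under products
  is the previous lemma, and \<open>Re\<close> and \<open>Im\<close> separate points.\<close>

lemma Re_poly_dense_on_circle:
  fixes \<phi> :: "complex \<Rightarrow> real"
  assumes "continuous_on (sphere 0 1) \<phi>" "0 < \<epsilon>"
  obtains P where "\<And>z. z \<in> sphere 0 1 \<Longrightarrow> \<bar>\<phi> z - Re (poly P z)\<bar> < \<epsilon>"
proof -
  define R where "R = {f. \<exists>P. \<forall>z\<in>sphere (0::complex) 1. f z = Re (poly P z)}"
  interpret function_ring_on R "sphere (0::complex) 1"
  proof
    show "compact (sphere (0::complex) 1)" by simp
    show "continuous_on (sphere 0 1) f" if f: "f \<in> R" for f
    proof -
      obtain P where "\<And>z. z \<in> sphere 0 1 \<Longrightarrow> f z = Re (poly P z)"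
        using f by (auto simp: R_def)
      moreover have "continuous_on (sphere 0 1) (\<lambda>z. Re (poly P z))"
        by (intro continuous_intros)
      ultimately show ?thesis by (metis (no_types, lifting) continuous_on_cong)
    qed
    show "(\<lambda>x. f x + g x) \<in> R" if fg: "f \<in> R" "g \<in> R" for f g
    proof -
      obtain P Q where "\<And>z. z \<in> sphere 0 1 \<Longrightarrow> f z = Re (poly P z)"
        "\<And>z. z \<in> sphere 0 1 \<Longrightarrow> g z = Re (poly Q z)"
        using fg by (auto simp: R_def)
      then have "\<forall>z\<in>sphere 0 1. f z + g z = Re (poly (P + Q) z)" by simp
      then show ?thesis unfolding R_def by blast
    qed
    show "(\<lambda>x. f x * g x) \<in> R" if fg: "f \<in> R" "g \<in> R" for f g
    proof -
      obtain P Q where PQ: "\<And>z. z \<in> sphere 0 1 \<Longrightarrow> f z = Re (poly P z)"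
        "\<And>z. z \<in> sphere 0 1 \<Longrightarrow> g z = Re (poly Q z)"
        using fg by (auto simp: R_def)
      obtain S where "\<forall>z\<in>sphere 0 1. Re (poly P z) * Re (poly Q z) = Re (poly S z)"
        using Re_poly_mult_on_circle by blast
      then have "\<forall>z\<in>sphere 0 1. f z * g z = Re (poly S z)" using PQ by simp
      then show ?thesis unfolding R_def by blast
    qed
    show "(\<lambda>_. c) \<in> R" for c
      unfolding R_def by (auto intro!: exI[of _ "[:of_real c:]"])
    show "\<exists>f\<in>R. f x \<noteq> f y" if "x \<noteq> y" for x y
    proof (cases "Re x = Re y")
      case False
      moreover have "Re \<in> R"
        unfolding R_def by (auto intro!: exI[of _ "[:0, 1:]"])
      ultimately show ?thesis by blast
    next
      case True
      then have "Im x \<noteq> Im y" using that by (simp add: complex_eq_iff)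
      \<comment> \<open>\<open>Im z\<close> is the real part of \<open>- \<i> * z\<close>.\<close>
      moreover have "Im \<in> R"
        unfolding R_def by (auto intro!: exI[of _ "[:0, - \<i>:]"])
      ultimately show ?thesis by blast
    qed
  qed
  obtain g where g: "g \<in> R" "\<And>z. z \<in> sphere 0 1 \<Longrightarrow> \<bar>\<phi> z - g z\<bar> < \<epsilon>"
    using Stone_Weierstrass_basic[OF assms] by blast
  obtain P where "\<And>z. z \<in> sphere 0 1 \<Longrightarrow> g z = Re (poly P z)"
    using g(1) by (auto simp: R_def)
  then show thesis using g(2) that[of P] by simp
qed

text \<open>Cauchy's formula at the centre: on the circle the kernel \<open>1 / z\<close> cancels
  against the derivative of the parametrization, which leaves the mean value.\<close>

lemma has_integral_poly_circle:
  "((\<lambda>t. poly P (cis (2 * pi * t))) has_integral poly P 0) {0..1}"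
proof -
  have "((\<lambda>z. poly P z / (z - 0)) has_contour_integral (2 * of_real pi * \<i> * poly P 0)) (circlepath 0 1)"
    by (rule Cauchy_integral_circlepath_simple) (auto intro!: holomorphic_intros)
  then have "((\<lambda>t. poly P (cis (2 * pi * t)) / cis (2 * pi * t) * (2 * of_real pi * \<i> * cis (2 * pi * t)))
      has_integral (2 * of_real pi * \<i> * poly P 0)) {0..1}"
    unfolding has_contour_integral
  proof (rule has_integral_eq[rotated])
    fix t :: real
    have "circlepath 0 1 t = cis (2 * pi * t)"
      by (simp add: circlepath cis_conv_exp mult_ac)
    moreover have "vector_derivative (circlepath 0 1) (at t) = 2 * of_real pi * \<i> * cis (2 * pi * t)"
      by (simp add: vector_derivative_circlepath cis_conv_exp mult_ac)
    ultimately show "poly P (circlepath 0 1 t) / (circlepath 0 1 t - 0)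
        * vector_derivative (circlepath 0 1) (at t)
      = poly P (cis (2 * pi * t)) / cis (2 * pi * t) * (2 * of_real pi * \<i> * cis (2 * pi * t))"
      by simp
  qed
  then have "((\<lambda>t. (2 * of_real pi * \<i>) * poly P (cis (2 * pi * t)))
      has_integral (2 * of_real pi * \<i> * poly P 0)) {0..1}"
    by (simp add: mult_ac)
  from has_integral_mult_right[OF this, of "1 / (2 * of_real pi * \<i>)"]
  show ?thesis by simp
qed

section \<open>Boundary uniqueness in the disc\<close>

text \<open>Choose a polynomial \<open>P\<close> with \<open>Re P\<close> within \<open>1\<close> of \<open>ln (|h| + \<delta>)\<close> on the circle, apply the maximum
  principle to \<open>h exp (-P)\<close>, and compute \<open>Re P(0)\<close> as a mean over the circle.\<close>

lemma norm_at_0_le_if_zero_on_circle_set: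
  fixes h :: "complex \<Rightarrow> complex"
  assumes cont: "continuous_on (cball 0 1) h" and hol: "h holomorphic_on ball 0 1"
    and M: "\<And>z. z \<in> sphere 0 1 \<Longrightarrow> norm (h z) \<le> M"
    and T: "T \<in> sets borel" "T \<subseteq> {0..1}" "\<And>t. t \<in> T \<Longrightarrow> h (cis (2 * pi * t)) = 0"
    and \<delta>: "0 < \<delta>" "\<delta> \<le> 1"
  shows "norm (h 0) \<le> exp 2 * (M + 1) * \<delta> powr measure lborel T"
proof -
  \<comment> \<open>The shift by \<open>\<delta>\<close> keeps the logarithm finite and continuous
    at the zeros of \<open>h\<close>.\<close>
  define \<phi> where "\<phi> z = ln (norm (h z) + \<delta>)" for z
  have pos: "0 < norm (h z) + \<delta>" for z
    using \<delta> by (simp add: add_nonneg_pos)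
  have "0 \<le> M"
    using M[of 1] norm_ge_zero[of "h 1"] by (simp del: norm_ge_zero)
  have cont': "continuous_on (sphere 0 1) h"
    using cont by (rule continuous_on_subset) auto
  have "continuous_on (sphere 0 1) \<phi>"
    unfolding \<phi>_def using pos by (intro continuous_intros cont') (auto simp: less_imp_neq[symmetric])
  then obtain P where P: "\<And>z. z \<in> sphere 0 1 \<Longrightarrow> \<bar>\<phi> z - Re (poly P z)\<bar> < 1"
    using Re_poly_dense_on_circle[of \<phi> 1] by auto
  have "norm (h z * exp (- poly P z)) \<le> exp 1" if z: "z \<in> sphere 0 1" for z
  proof -
    have "norm (h z) \<le> exp (\<phi> z)"
      using pos[of z] \<delta> by (simp add: \<phi>_def)
    also have "\<dots> \<le> exp (1 + Re (poly P z))"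
      using P[OF z] by simp
    finally show ?thesis
      by (simp add: norm_mult norm_divide exp_add exp_minus field_simps)
  qed
  moreover have "(\<lambda>z. h z * exp (- poly P z)) holomorphic_on ball 0 1"
    using hol by (intro holomorphic_intros)
  moreover have "continuous_on (cball 0 1) (\<lambda>z. h z * exp (- poly P z))"
    using cont by (intro continuous_intros)
  ultimately have "norm (h 0 * exp (- poly P 0)) \<le> exp 1"
    using maximum_modulus_frontier[of "\<lambda>z. h z * exp (- poly P z)" "cball 0 1" "exp 1" 0] by simp
  then have 1: "norm (h 0) \<le> exp (1 + Re (poly P 0))"
    by (simp add: norm_mult norm_divide exp_add exp_minus field_simps)
  have "emeasure lborel T \<le> emeasure lborel {0..1::real}"
    using T by (intro emeasure_mono) auto
  then have "((\<lambda>t. 1) has_integral measure lborel T) T"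
    using T by (intro has_integral_measure_lborel) (auto simp: top.not_eq_extremum[symmetric] top_unique)
  then have "((\<lambda>t. if t \<in> T then 1 else 0) has_integral measure lborel T) {0..1}"
    using T(2) by (simp add: has_integral_restrict)
  \<comment> \<open>The integrand is a majorant of \<open>Re P\<close>: on \<open>T\<close> the
    function \<open>\<phi>\<close> equals \<open>ln \<delta>\<close>, elsewhere it is at most
    \<open>ln (M + 1)\<close> because \<open>\<delta> \<le> 1\<close>, and the remaining
    \<open>1\<close> is the approximation error.\<close>
  from has_integral_add[OF has_integral_mult_right[OF this, of "ln \<delta>"]
      has_integral_const_real[of "1 + ln (M + 1)" 0 1]]
  have I: "((\<lambda>t. ln \<delta> * (if t \<in> T then 1 else 0) + (1 + ln (M + 1)))
      has_integral (ln \<delta> * measure lborel T + (1 + ln (M + 1)))) {0..1}"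
    by simp
  have J: "((\<lambda>t. Re (poly P (cis (2 * pi * t)))) has_integral Re (poly P 0)) {0..1}"
    using has_integral_linear[OF has_integral_poly_circle bounded_linear_Re] by (simp add: o_def)
  have 2: "Re (poly P 0) \<le> ln \<delta> * measure lborel T + (1 + ln (M + 1))"
  proof (rule has_integral_le[OF J I])
    fix t :: real
    define z where "z = cis (2 * pi * t)"
    have z: "z \<in> sphere 0 1" by (simp add: z_def)
    have "\<phi> z \<le> ln \<delta> * (if t \<in> T then 1 else 0) + ln (M + 1)"
    proof (cases "t \<in> T")
      case True
      then show ?thesis using T(3) \<open>0 \<le> M\<close> by (simp add: \<phi>_def z_def)
    next
      case False
      have "ln (norm (h z) + \<delta>) \<le> ln (M + 1)"
        using pos[of z] M[OF z] \<delta> by (subst ln_le_cancel_iff) auto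
      then show ?thesis using False by (simp add: \<phi>_def)
    qed
    then show "Re (poly P (cis (2 * pi * t))) \<le> ln \<delta> * (if t \<in> T then 1 else 0) + (1 + ln (M + 1))"
      using P[OF z] by (simp add: z_def)
  qed
  \<comment> \<open>Of the constant \<open>2\<close>, one unit comes from the maximum principle and
    one from the majorant of \<open>Re P\<close>.\<close>
  have "norm (h 0) \<le> exp (2 + (ln \<delta> * measure lborel T + ln (M + 1)))"
    using 1 2 by (smt (verit) exp_le_cancel_iff)
  also have "\<dots> = exp 2 * (M + 1) * \<delta> powr measure lborel T"
    using \<delta> \<open>0 \<le> M\<close> by (simp add: exp_add powr_def mult_ac)
  finally show ?thesis .
qed

text \<open>In the previous bound only the factor \<open>\<delta> powr measure lborel T\<close>
  depends on \<open>\<delta>\<close>; its exponent is positive, so it tends to \<open>0\<close> with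
  \<open>\<delta>\<close>.\<close>

lemma zero_at_0_if_zero_on_circle_set:
  fixes h :: "complex \<Rightarrow> complex"
  assumes cont: "continuous_on (cball 0 1) h" and hol: "h holomorphic_on ball 0 1"
    and T: "T \<in> sets borel" "T \<subseteq> {0..1}" "\<And>t. t \<in> T \<Longrightarrow> h (cis (2 * pi * t)) = 0"
    and pos: "0 < measure lborel T"
  shows "h 0 = 0"
proof -
  have "bounded (h ` cball 0 1)"
    using cont by (intro compact_imp_bounded compact_continuous_image) auto
  then obtain M where M: "\<And>z. z \<in> cball 0 1 \<Longrightarrow> norm (h z) \<le> M"
    unfolding bounded_iff by blast
  have "((\<lambda>\<delta>. exp 2 * (M + 1) * \<delta> powr measure lborel T) \<longlongrightarrow> exp 2 * (M + 1) * 0 powr measure lborel T)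
      (at_right 0)"
    using pos by (intro tendsto_intros tendsto_powr') (auto simp: eventually_at_filter)
  moreover have "\<forall>\<^sub>F \<delta> in at_right 0. norm (h 0) \<le> exp 2 * (M + 1) * \<delta> powr measure lborel T"
    using eventually_at_right_real[of 0 1]
    by (auto elim!: eventually_mono intro!: norm_at_0_le_if_zero_on_circle_set[OF cont hol M T])
  ultimately have "norm (h 0) \<le> exp 2 * (M + 1) * 0 powr measure lborel T"
    by (intro tendsto_lowerbound) auto
  then show ?thesis using pos by simp
qed

text \<open>Passes from the centre to the whole disc. If \<open>h\<close> were not identically zero,
  dividing by \<open>z ^ n\<close>, with \<open>n\<close> its order of vanishing at
  \<open>0\<close>, would give a function with the same boundary zeros but a nonzero value at
  \<open>0\<close>, against the previous lemma.\<close>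

lemma zero_on_disc_if_zero_on_circle_set:
  fixes h :: "complex \<Rightarrow> complex"
  assumes cont: "continuous_on (cball 0 1) h" and hol: "h holomorphic_on ball 0 1"
    and T: "T \<in> sets borel" "T \<subseteq> {0..1}" "\<And>t. t \<in> T \<Longrightarrow> h (cis (2 * pi * t)) = 0"
    and pos: "0 < measure lborel T" and z: "z \<in> ball 0 1"
  shows "h z = 0"
proof (rule ccontr)
  assume nz: "h z \<noteq> 0"
  have h0: "h 0 = 0"
    by (rule zero_at_0_if_zero_on_circle_set[OF cont hol T pos])
  then have "\<not> h constant_on ball 0 1"
    using nz z unfolding constant_on_def by (metis centre_in_ball zero_less_one)
  then obtain g r n where "0 < n" and r: "0 < r" "ball (0::complex) r \<subseteq> ball 0 1" and g: "g holomorphic_on ball 0 r"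
    "\<And>w. w \<in> ball 0 r \<Longrightarrow> h w = (w - 0) ^ n * g w" "\<And>w. w \<in> ball 0 r \<Longrightarrow> g w \<noteq> 0"
    by (rule holomorphic_factor_zero_nonconstant[OF hol open_ball connected_ball centre_in_ball[THEN iffD2, OF zero_less_one] h0]) (rule that)
  \<comment> \<open>\<open>G\<close> is the quotient \<open>h w / w ^ n\<close> with its removable
    singularity at \<open>0\<close> filled in by the local factor \<open>g\<close>.\<close>
  define G where "G w = (if w \<in> ball 0 r then g w else h w / w ^ n)" for w
  have eq: "G w = h w / w ^ n" if "w \<noteq> 0" for w
    using g(2)[of w] that by (auto simp: G_def)
  have cont0: "continuous_on (cball 0 1 - {0}) (\<lambda>w. h w / w ^ n)"
    by (intro continuous_intros continuous_on_subset[OF cont]) auto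
  have hol1: "G holomorphic_on ball 0 r"
    using g(1) by (rule holomorphic_transform) (simp add: G_def)
  have hol2: "G holomorphic_on ball 0 1 - {0}"
  proof (rule holomorphic_transform)
    show "(\<lambda>w. h w / w ^ n) holomorphic_on ball 0 1 - {0}"
      by (intro holomorphic_intros holomorphic_on_subset[OF hol]) auto
  qed (auto simp: eq)
  have "G holomorphic_on ball 0 r \<union> (ball 0 1 - {0})"
    using hol1 hol2 by (intro holomorphic_on_Un) (auto intro: open_delete)
  moreover have "ball 0 1 = ball 0 r \<union> (ball 0 1 - {0::complex})"
    using r by auto
  ultimately have holG: "G holomorphic_on ball 0 1" by simp
  have isCont: "isCont G w" if "w \<in> ball 0 1" for w
    using continuous_on_eq_continuous_at[OF open_ball] holomorphic_on_imp_continuous_on[OF holG] that by blast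
  have contG0: "continuous_on (cball 0 1 - {0}) G"
    using cont0 by (rule continuous_on_eq) (simp add: eq)
  \<comment> \<open>Continuity at \<open>0\<close> comes from holomorphy of \<open>G\<close>, at all
    other points up to the boundary from the quotient.\<close>
  have "continuous (at w within cball 0 1) G" if w: "w \<in> cball 0 1" for w
  proof (cases "w = 0")
    case True
    then show ?thesis using isCont[of 0] by (simp add: continuous_at_imp_continuous_at_within)
  next
    case False
    then have "continuous (at w within cball 0 1 - {0}) G"
      using contG0 w by (simp add: continuous_on_eq_continuous_within)
    moreover have "at w within cball 0 1 - {0} = at w within cball 0 1"
      using False by (intro at_within_nhd[of w "- {0}"]) auto
    ultimately show ?thesis by simp
  qed
  then have contG: "continuous_on (cball 0 1) G"
    by (simp add: continuous_on_eq_continuous_within)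
  have "G 0 = 0"
    by (rule zero_at_0_if_zero_on_circle_set[OF contG holG T(1,2) _ pos]) (simp add: eq T(3))
  then show False
    using g(3)[of 0] r by (simp add: G_def)
qed

section \<open>Complex scalars and complex lines in several variables\<close>

lemma norm_vector_smult_complex: "norm (c *s x) = norm c * norm (x :: complex^'d)"
  by (simp add: norm_vec_def norm_mult L2_set_right_distrib)

lemma of_real_vector_smult: "of_real r *s x = r *\<^sub>R (x :: complex^'d)"
  unfolding vec_eq_iff by (simp add: scaleR_conv_of_real[where 'a = complex])

lemma sgn_vector_smult:
  assumes "norm c = 1"
  shows "sgn (c *s x) = c *s sgn (x :: complex^'d)"
  using assms
  by (simp add: sgn_div_norm norm_vector_smult_complex vec_eq_iff scaleR_conv_of_real mult_ac)

lemma orthogonal_transformation_vector_smult: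
  assumes "norm c = 1"
  shows "orthogonal_transformation (\<lambda>x :: complex^'d. c *s x)"
  unfolding orthogonal_transformation
  using assms
  by (auto intro!: linearI simp: norm_vector_smult_complex vec_eq_iff algebra_simps)

lemma bounded_linear_vector_smult_left: "bounded_linear (\<lambda>c. c *s (x :: complex^'d))"
  by (rule bounded_linear_intro[of _ "norm x"])
     (auto simp: norm_vector_smult_complex vec_eq_iff algebra_simps)

text \<open>By the chain rule the derivative along the line is
  \<open>\<lambda>c. D (c *s x)\<close>, and complex linearity of \<open>D\<close> turns this into
  multiplication by the number \<open>D x\<close>.\<close>

lemma holomorphic_Cd_line:
  assumes f: "holomorphic_Cd f S"
  shows "(\<lambda>c. f (p + c *s x)) holomorphic_on {c. p + c *s x \<in> S}"
proof (rule holomorphic_onI, rule field_differentiable_at_within)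
  fix c assume "c \<in> {c. p + c *s x \<in> S}"
  then obtain D where D: "(f has_derivative D) (at (p + c *s x))" "\<And>c v. D (c *s v) = c * D v"
    using f unfolding holomorphic_Cd_def by blast
  have "((\<lambda>c. p + c *s x) has_derivative (\<lambda>c. c *s x)) (at c)"
    using bounded_linear_vector_smult_left[of x]
    by (auto intro!: derivative_eq_intros bounded_linear_imp_has_derivative)
  from has_derivative_compose[OF this D(1)]
  have "((\<lambda>c. f (p + c *s x)) has_derivative (\<lambda>c. D (c *s x))) (at c)" .
  then have "((\<lambda>c. f (p + c *s x)) has_field_derivative D x) (at c)"
    by (simp add: D(2) has_field_derivative_def mult.commute[of _ "D x"])
  then show "(\<lambda>c. f (p + c *s x)) field_differentiable at c"
    using field_differentiable_def by blast
qed

section \<open>Zero sets of holomorphic functions inside the ball\<close>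

text \<open>Supplies the premise of \<open>holomorphic_countable_zeros\<close> for the domain of a
  slice.\<close>

lemma open_imp_fsigma:
  fixes S :: "'a::euclidean_space set"
  assumes "open S"
  shows "fsigma S"
  using open_Union_compact_subsets[OF assms] unfolding fsigma_Union_compact
  by (metis image_subset_iff mem_Collect_eq)

text \<open>Extend the ray to the complex line through \<open>p\<close>. The slice is holomorphic on
  a convex open set and nonzero at the parameter \<open>0\<close>, so its zeros are countable; the
  real ones are among them.\<close>

lemma countable_zeros_on_ray:
  assumes f: "holomorphic_Cd f (ball 0 1)" and p: "p \<in> ball 0 1" "f p \<noteq> 0"
  shows "countable {t. p + t *\<^sub>R x \<in> ball 0 1 \<and> f (p + t *\<^sub>R x) = 0}"
proof -
  define S where "S = {c. p + c *s x \<in> ball 0 1}"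
  define k where "k c = f (p + c *s x)" for c
  have hol: "k holomorphic_on S"
    unfolding S_def k_def by (rule holomorphic_Cd_line[OF f])
  have S_eq: "S = (\<lambda>c. c *s x) -` ball (-p) 1"
    by (auto simp: S_def dist_norm norm_minus_commute[of "-p"] add.commute)
  have lin: "linear (\<lambda>c. c *s x)"
    using bounded_linear_vector_smult_left[of x] by (rule bounded_linear.linear)
  have "open S"
    unfolding S_eq using bounded_linear_vector_smult_left[of x]
    by (intro open_vimage) (auto intro: linear_continuous_on)
  moreover have "convex S"
    unfolding S_eq by (rule convex_linear_vimage[OF lin]) simp
  ultimately have S: "open S" "connected S" "fsigma S"
    by (auto simp: convex_connected intro: open_imp_fsigma)
  have "0 \<in> S" "k 0 \<noteq> 0"
    using p by (auto simp: S_def k_def)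
  have "countable {c \<in> S. k c = 0}"
  proof (cases "k constant_on S")
    case True
    then have "{c \<in> S. k c = 0} = {}"
      using \<open>0 \<in> S\<close> \<open>k 0 \<noteq> 0\<close> unfolding constant_on_def by force
    then show ?thesis by (simp only: countable_empty)
  next
    case False
    then show ?thesis by (rule holomorphic_countable_zeros[OF hol S])
  qed
  moreover have "of_real ` {t. p + t *\<^sub>R x \<in> ball 0 1 \<and> f (p + t *\<^sub>R x) = 0} \<subseteq> {c \<in> S. k c = 0}"
    by (auto simp: S_def k_def of_real_vector_smult)
  ultimately have "countable ((of_real :: real \<Rightarrow> complex) ` {t. p + t *\<^sub>R x \<in> ball 0 1 \<and> f (p + t *\<^sub>R x) = 0})"
    using countable_subset by blast
  then show ?thesis
    by (rule countable_image_inj_on) (simp add: inj_on_def)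
qed

text \<open>If \<open>f p\<close> were nonzero, every ray from \<open>p\<close> would meet the zero set in countably many points.
  Integrating its indicator at \<open>p + t x\<close> over \<open>x\<close> and over \<open>t\<close> in \<open>[1,2]\<close>, a substitute for polar
  coordinates, would then give \<open>0\<close>.\<close>

lemma holomorphic_Cd_zero_if_zero_on_nonnull:
  fixes f :: "complex^'d \<Rightarrow> complex"
  assumes f: "holomorphic_Cd f (ball 0 1)"
    and Z [measurable]: "{z \<in> ball 0 1. f z = 0} \<in> sets borel"
    and pos: "emeasure lborel {z \<in> ball 0 1. f z = 0} \<noteq> 0"
    and p: "p \<in> ball 0 1"
  shows "f p = 0"
proof (rule ccontr)
  assume nz: "f p \<noteq> 0"
  define Z where "Z = {z \<in> ball 0 1. f z = 0}"
  have [measurable]: "Z \<in> sets borel" using Z by (simp add: Z_def)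
  define J where "J t = (\<integral>\<^sup>+x. indicator Z (p + t *\<^sub>R x) \<partial>lborel)" for t :: real
  \<comment> \<open>The substitution \<open>y = p + t *\<^sub>R x\<close> shows that the measure of
    \<open>Z\<close> is \<open>J t\<close> times a power of \<open>\<bar>t\<bar>\<close>.\<close>
  have J: "J t \<noteq> 0" if "t \<noteq> 0" for t
  proof
    assume J0: "J t = 0"
    have "emeasure lborel Z = emeasure (density (distr lborel borel (\<lambda>x. p + t *\<^sub>R x))
        (\<lambda>_. ennreal (\<bar>t\<bar> ^ DIM(complex^'d)))) Z"
      using lborel_affine[OF that, of p] by simp
    also have "\<dots> = ennreal (\<bar>t\<bar> ^ DIM(complex^'d))
        * (\<integral>\<^sup>+y. indicator Z y \<partial>distr lborel borel (\<lambda>x. p + t *\<^sub>R x))"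
      by (simp add: emeasure_density nn_integral_cmult)
    also have "(\<integral>\<^sup>+y. indicator Z y \<partial>distr lborel borel (\<lambda>x. p + t *\<^sub>R x)) = J t"
      unfolding J_def by (rule nn_integral_distr) measurable
    finally show False using J0 pos by (simp add: Z_def)
  qed
  have "(\<integral>\<^sup>+t. indicator {1..2} t * J t \<partial>lborel)
      = (\<integral>\<^sup>+t. (\<integral>\<^sup>+x. indicator {1..2} t * indicator Z (p + t *\<^sub>R x) \<partial>lborel) \<partial>lborel)"
    unfolding J_def by (intro nn_integral_cong nn_integral_cmult[symmetric]) measurable
  also have "\<dots> = (\<integral>\<^sup>+x. (\<integral>\<^sup>+t. indicator {1..2} t * indicator Z (p + t *\<^sub>R x) \<partial>lborel) \<partial>lborel)"
    by (rule lborel_pair.Fubini') measurable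
  also have "\<dots> = (\<integral>\<^sup>+x. 0 \<partial>(lborel :: (complex^'d) measure))"
  proof (rule nn_integral_cong)
    fix x :: "complex^'d"
    have "AE t in lborel. t \<notin> {t. p + t *\<^sub>R x \<in> Z}"
      using countable_imp_null_set_lborel[OF countable_zeros_on_ray[OF f p nz, of x]]
      by (intro AE_not_in) (simp add: Z_def)
    then have "AE t in lborel. indicator {1..2} t * indicator Z (p + t *\<^sub>R x) = (0::ennreal)"
      by eventually_elim auto
    then show "(\<integral>\<^sup>+t. indicator {1..2} t * indicator Z (p + t *\<^sub>R x) \<partial>lborel) = 0"
      by (subst nn_integral_0_iff_AE) (auto simp: mult.commute)
  qed
  finally have "(\<integral>\<^sup>+t. indicator {1..2} t * J t \<partial>lborel) = 0" by simp
  moreover have "(\<lambda>t. indicator {1..2} t * J t) \<in> borel_measurable lborel"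
    unfolding J_def by measurable
  ultimately have "AE t in lborel. indicator {1..2} t * J t = 0"
    by (subst (asm) nn_integral_0_iff_AE) auto
  \<comment> \<open>As \<open>J\<close> does not vanish on \<open>{1..2}\<close>, this interval
    would have to be a null set.\<close>
  then have "AE t in lborel. t \<notin> {1..2::real}"
    by eventually_elim (use J in \<open>auto simp: indicator_def\<close>)
  then have "emeasure lborel {1..2::real} = 0"
    by (subst (asm) AE_iff_measurable[of "{1..2}"]) auto
  then show False by simp
qed

section \<open>From zeros on the sphere to zeros in the ball\<close>

lemma closed_boundary_zero_set:
  assumes "continuous_on (cball 0 1) F"
  shows "closed (boundary_zero_set F)"
proof -
  have "continuous_on (sphere 0 1) F"
    using assms by (rule continuous_on_subset) auto
  then have "closed (sphere 0 1 \<inter> F -` {0})"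
    by (intro continuous_closed_preimage) auto
  moreover have "boundary_zero_set F = sphere 0 1 \<inter> F -` {0}"
    by (auto simp: boundary_zero_set_def)
  ultimately show ?thesis by simp
qed

text \<open>With \<open>w = sgn x\<close>, a unimodular \<open>c\<close> satisfies
  \<open>sgn (c *s x) = c *s w\<close>. So the slice \<open>c \<mapsto> F (c *s w)\<close> vanishes
  on a nonnull set of the circle, hence on the disc, and \<open>x\<close> is its point with
  parameter \<open>norm x\<close>.\<close>

lemma zero_if_boundary_slice_nonnull:
  fixes F :: "complex^'d \<Rightarrow> complex"
  assumes cont: "continuous_on (cball 0 1) F" and hol: "holomorphic_Cd F (ball 0 1)"
    and x: "x \<in> ball 0 1"
    and pos: "emeasure lborel {t \<in> {0..1}. sgn (cis (2 * pi * t) *s x) \<in> boundary_zero_set F} \<noteq> 0"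
  shows "F x = 0"
proof -
  define E where "E = boundary_zero_set F"
  define T where "T = {t \<in> {0..1}. sgn (cis (2 * pi * t) *s x) \<in> E}"
  define w where "w = sgn x"
  \<comment> \<open>For \<open>x = 0\<close> the set would be empty, since \<open>sgn 0 = 0\<close>
    is not on the sphere.\<close>
  have "x \<noteq> 0"
    using pos by (auto simp: boundary_zero_set_def)
  then have w: "norm w = 1" by (simp add: w_def norm_sgn)
  have T_eq: "T = {0..1} \<inter> (\<lambda>t. cis (2 * pi * t) *s w) -` E"
    by (auto simp: T_def w_def sgn_vector_smult)
  note cont_smult = bounded_linear.continuous_on[OF bounded_linear_vector_smult_left]
  have "closed T"
    unfolding T_eq E_def
    by (intro continuous_closed_preimage closed_boundary_zero_set[OF cont] cont_smult continuous_intros)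
  then have T: "T \<in> sets borel" "T \<subseteq> {0..1}" by (auto simp: T_eq)
  have "emeasure lborel T \<le> emeasure lborel {0..1::real}"
    using T by (intro emeasure_mono) auto
  then have "emeasure lborel T \<noteq> \<infinity>" by (auto simp: top_unique)
  then have mT: "0 < measure lborel T"
    using pos by (simp add: T_def E_def measure_def enn2real_positive_iff less_top zero_less_iff_neq_zero)
  have "F (0 + of_real (norm x) *s w) = 0"
  proof (rule zero_on_disc_if_zero_on_circle_set[where h = "\<lambda>c. F (0 + c *s w)", OF _ _ T _ mT])
    show "continuous_on (cball 0 1) (\<lambda>c. F (0 + c *s w))"
      by (rule continuous_on_compose2[OF cont])
         (auto intro!: continuous_intros cont_smult simp: norm_vector_smult_complex w)
    show "(\<lambda>c. F (0 + c *s w)) holomorphic_on ball 0 1"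
      by (rule holomorphic_on_subset[OF holomorphic_Cd_line[OF hol]])
         (auto simp: norm_vector_smult_complex w)
    show "F (0 + cis (2 * pi * t) *s w) = 0" if "t \<in> T" for t
      using that by (auto simp: T_eq E_def boundary_zero_set_def)
    show "of_real (norm x) \<in> ball (0::complex) 1" using x by simp
  qed
  then show ?thesis
    by (simp add: of_real_vector_smult w_def sgn_div_norm \<open>x \<noteq> 0\<close>)
qed

lemma holomorphic_Cd_cong:
  assumes "open S" "\<And>z. z \<in> S \<Longrightarrow> f z = g z" "holomorphic_Cd f S"
  shows "holomorphic_Cd g S"
  unfolding holomorphic_Cd_def
proof
  fix z assume z: "z \<in> S"
  then obtain D where D: "(f has_derivative D) (at z)" "\<forall>c v. D (c *s v) = c * D v"
    using assms(3) unfolding holomorphic_Cd_def by blast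
  have "(g has_derivative D) (at z)"
    using has_derivative_transform_within_open[OF D(1) assms(1) z] assms(2) by blast
  then show "\<exists>D. (g has_derivative D) (at z) \<and> (\<forall>c v. D (c *s v) = c * D v)"
    using D(2) by blast
qed

text \<open>Integrate the indicator of a cone over the boundary zeros at
  \<open>cis (2 * pi * t) *s x\<close> over \<open>t\<close> and \<open>x\<close>. Integrating over
  \<open>x\<close> first gives the positive measure of the cone, by rotation invariance; integrating
  over \<open>t\<close> first gives \<open>0\<close> for each \<open>x\<close> outside the interior
  zero set, by the slice lemma. Hence the interior zero set is not null.\<close>

lemma zero_if_boundary_zero_set_nonnull:
  fixes F :: "complex^'d \<Rightarrow> complex"
  assumes cont: "continuous_on (cball 0 1) F" and hol: "holomorphic_Cd F (ball 0 1)"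
    and pos: "emeasure sphere_measure (boundary_zero_set F) \<noteq> 0"
    and p: "p \<in> ball 0 1"
  shows "F p = 0"
proof (rule holomorphic_Cd_zero_if_zero_on_nonnull[OF hol _ _ p])
  define E where "E = boundary_zero_set F"
  define Z where "Z = {z \<in> ball 0 1. F z = 0}"
  have [measurable]: "E \<in> sets borel"
    using closed_boundary_zero_set[OF cont] by (simp add: E_def)
  have E_sphere: "E \<subseteq> sphere 0 1" by (auto simp: E_def boundary_zero_set_def)
  have "closed (cball 0 1 \<inter> F -` {0})"
    by (intro continuous_closed_preimage cont) auto
  moreover have "Z = ball 0 1 \<inter> (cball 0 1 \<inter> F -` {0})"
    by (auto simp: Z_def)
  ultimately have Z [measurable]: "Z \<in> sets borel" by simp
  then show "{z \<in> ball 0 1. F z = 0} \<in> sets borel" by (simp add: Z_def)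
  \<comment> \<open>\<open>C\<close> is the radial cone over \<open>E\<close> inside the ball; up to
    normalization its volume is the surface measure of \<open>E\<close>.\<close>
  define C where "C = ball 0 1 \<inter> sgn -` E"
  have "sgn -` E \<in> sets (borel :: (complex^'d) measure)"
    using measurable_sets[OF measurable_sgn_borel, of E] by simp
  then have C [measurable]: "C \<in> sets borel" by (simp add: C_def)
  have C0: "emeasure lborel C \<noteq> 0"
    using pos emeasure_sphere_measure[OF _ E_sphere] by (auto simp: C_def E_def[symmetric])
  have cont_rot: "continuous_on UNIV (\<lambda>(t, x :: complex^'d). cis (2 * pi * t) *s x)"
    unfolding vector_scalar_mult_def case_prod_beta by (intro continuous_intros)
  have rot [measurable]: "(\<lambda>(t, x :: complex^'d). cis (2 * pi * t) *s x) \<in> borel_measurable (borel \<Otimes>\<^sub>M borel)"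
    using borel_measurable_continuous_onI[OF cont_rot] by (simp add: borel_prod)
  have ind [measurable]: "(\<lambda>(t, x). indicator {0..1} t * indicator C (cis (2 * pi * t) *s x) :: ennreal)
      \<in> borel_measurable (lborel \<Otimes>\<^sub>M lborel)"
    using rot by measurable
  show "emeasure lborel {z \<in> ball 0 1. F z = 0} \<noteq> 0"
  proof
    assume "emeasure lborel {z \<in> ball 0 1. F z = 0} = 0"
    then have "Z \<in> null_sets lborel" using Z by (simp add: null_sets_def Z_def)
    then have AE_Z: "AE x in lborel. x \<notin> Z" by (rule AE_not_in)
    have slice: "(\<integral>\<^sup>+t. indicator {0..1} t * indicator C (cis (2 * pi * t) *s x) \<partial>lborel) = (0::ennreal)"
      if "x \<notin> Z" for x
    proof -
      have [measurable]: "{t \<in> {0..1}. cis (2 * pi * t) *s x \<in> C} \<in> sets borel"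
      proof -
        have "(\<lambda>t. cis (2 * pi * t) *s x) \<in> borel_measurable borel"
          by (intro borel_measurable_continuous_onI bounded_linear.continuous_on[OF bounded_linear_vector_smult_left]
              continuous_intros)
        from measurable_sets[OF this C] have "(\<lambda>t. cis (2 * pi * t) *s x) -` C \<in> sets borel" by simp
        moreover have "{t \<in> {0..1}. cis (2 * pi * t) *s x \<in> C} = {0..1} \<inter> (\<lambda>t. cis (2 * pi * t) *s x) -` C"
          by auto
        ultimately show ?thesis by simp
      qed
      have "emeasure lborel {t \<in> {0..1}. cis (2 * pi * t) *s x \<in> C} = 0"
      \<comment> \<open>In the ball this is the contrapositive of the slice lemma; a point outside
        the ball stays outside under rotation and never meets \<open>C\<close>.\<close>
      proof (cases "x \<in> ball 0 1")
        case True
        then have "emeasure lborel {t \<in> {0..1}. sgn (cis (2 * pi * t) *s x) \<in> E} = 0"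
          using zero_if_boundary_slice_nonnull[OF cont hol True] that by (auto simp: E_def Z_def)
        moreover have "{t \<in> {0..1}. cis (2 * pi * t) *s x \<in> C} = {t \<in> {0..1}. sgn (cis (2 * pi * t) *s x) \<in> E}"
          using True by (auto simp: C_def norm_vector_smult_complex)
        ultimately show ?thesis by simp
      next
        case False
        then have "{t \<in> {0..1}. cis (2 * pi * t) *s x \<in> C} = {}"
          by (auto simp: C_def norm_vector_smult_complex)
        then show ?thesis by (simp only: emeasure_empty)
      qed
      moreover have "indicator {0..1} t * indicator C (cis (2 * pi * t) *s x)
          = (indicator {t \<in> {0..1}. cis (2 * pi * t) *s x \<in> C} t :: ennreal)" for t
        by (auto simp: indicator_def)
      ultimately show ?thesis by simp
    qed
    from AE_Z have AE0: "AE x in lborel.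
        (\<integral>\<^sup>+t. indicator {0..1} t * indicator C (cis (2 * pi * t) *s x) \<partial>lborel) = (0::ennreal)"
      by eventually_elim (rule slice)
    have "emeasure lborel C = (\<integral>\<^sup>+t. indicator {0..1} t * emeasure lborel C \<partial>(lborel :: real measure))"
      by (simp add: nn_integral_multc)
    also have "\<dots> = (\<integral>\<^sup>+t. (\<integral>\<^sup>+x. indicator {0..1} t * indicator C (cis (2 * pi * t) *s x) \<partial>lborel) \<partial>lborel)"
    proof (rule nn_integral_cong)
      fix t :: real
      have ot: "orthogonal_transformation (\<lambda>x :: complex^'d. cis (2 * pi * t) *s x)"
        by (rule orthogonal_transformation_vector_smult) simp
      have "(\<lambda>x. cis (2 * pi * t) *s x) \<in> borel_measurable (borel :: (complex^'d) measure)"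
        using ot by (intro borel_measurable_continuous_onI linear_continuous_on)
          (simp add: orthogonal_transformation_linear linear_conv_bounded_linear[symmetric])
      from measurable_sets[OF this C]
      have m: "(\<lambda>x. cis (2 * pi * t) *s x) -` C \<in> sets borel" by simp
      have "(\<integral>\<^sup>+x. indicator {0..1} t * indicator C (cis (2 * pi * t) *s x) \<partial>lborel)
          = (\<integral>\<^sup>+x. indicator {0..1} t * indicator ((\<lambda>x. cis (2 * pi * t) *s x) -` C) x \<partial>lborel)"
        by (simp add: indicator_def)
      also have "\<dots> = indicator {0..1} t * emeasure lborel ((\<lambda>x. cis (2 * pi * t) *s x) -` C)"
        using m by (simp add: nn_integral_cmult)
      finally show "indicator {0..1} t * emeasure lborel C
          = (\<integral>\<^sup>+x. indicator {0..1} t * indicator C (cis (2 * pi * t) *s x) \<partial>lborel)"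
        by (simp add: emeasure_lborel_orthogonal_vimage[OF ot C])
    qed
    also have "\<dots> = (\<integral>\<^sup>+x. (\<integral>\<^sup>+t. indicator {0..1} t * indicator C (cis (2 * pi * t) *s x) \<partial>lborel) \<partial>lborel)"
      by (rule lborel_pair.Fubini'[OF ind, symmetric])
    also have "\<dots> = (\<integral>\<^sup>+x. 0 \<partial>(lborel :: (complex^'d) measure))"
      using AE0 by (rule nn_integral_cong_AE)
    finally show False using C0 by simp
  qed
qed

section \<open>Capacity and surface measure\<close>

text \<open>The powers of the test functions converge pointwise to the indicator of
  \<open>E\<close>, since \<open>E\<close> is closed, and are dominated by \<open>1\<close>, which
  is integrable for the finite measure.\<close>

lemma capacity_le_measure:
  fixes E :: "(complex^'d) set"
  assumes "closed E" "E \<subseteq> sphere 0 1" "0 < \<alpha>"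
  shows "capacity \<alpha> E \<le> measure sphere_measure E"
proof -
  define S where "S = {\<integral>w. g w powr \<alpha> \<partial>sphere_measure | g::complex^'d \<Rightarrow> real.
            continuous_on (sphere 0 1) g \<and> (\<forall>w\<in>sphere 0 1. g w \<ge> 0) \<and> (\<forall>w\<in>E. g w \<ge> 1)}"
  have cap: "capacity \<alpha> E = Inf S" by (simp add: capacity_def S_def)
  have "0 \<le> s" if "s \<in> S" for s
    using that by (auto simp: S_def)
  then have bdd: "bdd_below S" by (auto simp: bdd_below_def)
  interpret finite_measure "sphere_measure :: (complex^'d) measure"
    by standard (simp add: emeasure_sphere_measure_space)
  have setsE: "E \<in> sets sphere_measure"
    using assms by (auto simp: sets_sphere_measure sets_restrict_space)
  \<comment> \<open>The empty set is treated apart because \<open>infdist w {}\<close> is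
    \<open>0\<close> by convention, which would make the test function \<open>1\<close>
    everywhere.\<close>
  define g where "g n w = (if E = {} then 0 else max 0 (1 - real n * infdist w E))"
    for n :: nat and w :: "complex^'d"
  have cont: "continuous_on A (g n)" for A n
    unfolding g_def by (cases "E = {}") (auto intro!: continuous_intros)
  have g1: "g n w \<le> 1" "0 \<le> g n w" for n w
    by (auto simp: g_def infdist_nonneg)
  have "(\<integral>w. g n w powr \<alpha> \<partial>sphere_measure) \<in> S" for n
    unfolding S_def mem_Collect_eq
    by (rule exI[of _ "g n"]) (use cont g1 in \<open>auto simp: g_def\<close>)
  then have le: "capacity \<alpha> E \<le> (\<integral>w. g n w powr \<alpha> \<partial>sphere_measure)" for n
    unfolding cap using bdd by (rule cInf_lower)
  have lim: "(\<lambda>n. g n w powr \<alpha>) \<longlonglongrightarrow> indicator E w" for w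
  proof (cases "w \<in> E")
    case True
    then have "g n w = 1" for n by (auto simp: g_def)
    then show ?thesis using True by simp
  next
    case False
    have "\<forall>\<^sub>F n in sequentially. g n w powr \<alpha> = 0"
    proof (cases "E = {}")
      case ne: False
      then have d: "0 < infdist w E"
        using False assms(1) by (rule infdist_pos_not_in_closed[rotated])
      \<comment> \<open>From such \<open>n\<close> on the cutoff is reached, and
        \<open>0 powr \<alpha> = 0\<close>.\<close>
      have "\<forall>\<^sub>F n in sequentially. 1 / infdist w E \<le> real n"
        using filterlim_real_sequentially by (simp add: filterlim_at_top)
      then show ?thesis
        by eventually_elim (use d in \<open>simp add: g_def divide_le_eq\<close>)
    qed (simp add: g_def)
    then have "(\<lambda>n. g n w powr \<alpha>) \<longlonglongrightarrow> 0" by (rule tendsto_eventually)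
    then show ?thesis using False by simp
  qed
  have meas: "(\<lambda>w. g n w powr \<alpha>) \<in> borel_measurable sphere_measure" for n
  proof -
    have "g n \<in> borel_measurable borel"
      using cont by (rule borel_measurable_continuous_onI)
    then have "(\<lambda>w. g n w powr \<alpha>) \<in> borel_measurable borel" by measurable
    then show ?thesis
      using measurable_restrict_space1 measurable_cong_sets[OF sets_sphere_measure refl] by blast
  qed
  have "(\<lambda>n. \<integral>w. g n w powr \<alpha> \<partial>sphere_measure) \<longlonglongrightarrow> (\<integral>w. indicator E w \<partial>sphere_measure)"
  proof (rule integral_dominated_convergence[where w = "\<lambda>_. 1"])
    show "AE w in sphere_measure. norm (g n w powr \<alpha>) \<le> 1" for n
      using g1 assms(3) by (auto intro!: powr_le1)
  qed (use lim meas setsE in auto)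
  then have "(\<lambda>n. \<integral>w. g n w powr \<alpha> \<partial>sphere_measure) \<longlonglongrightarrow> measure sphere_measure E"
    using setsE sets.sets_into_space[OF setsE] by (simp add: Int_absorb2)
  then show ?thesis
    by (rule LIMSEQ_le_const) (use le in auto)
qed

section \<open>Besov norms of constants and non-cyclicity of zero\<close>

text \<open>Complex derivatives are local: for small \<open>t\<close> the shifted points remain in
  the open set \<open>S\<close>. This lets values outside the ball be ignored.\<close>

lemma radial_deriv_cong:
  fixes f g :: "complex^'d \<Rightarrow> complex"
  assumes "open S" "\<And>z. z \<in> S \<Longrightarrow> f z = g z" "z \<in> S"
  shows "radial_deriv f z = radial_deriv g z"
  unfolding radial_deriv_def
proof (rule sum.cong[OF refl])
  fix j :: 'd
  have "isCont (\<lambda>t. z + t *s axis j 1) 0"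
    by (intro continuous_intros bounded_linear.isCont[OF bounded_linear_vector_smult_left])
  then have "((\<lambda>t. z + t *s axis j 1) \<longlongrightarrow> z) (at 0)"
    by (simp add: isCont_def)
  then have "\<forall>\<^sub>F t in nhds 0. z + t *s axis j 1 \<in> S"
    using topological_tendstoD[OF _ assms(1,3)] assms(3) by (simp add: eventually_nhds_conv_at)
  then have "\<forall>\<^sub>F t in nhds 0. f (z + t *s axis j 1) = g (z + t *s axis j 1)"
    by eventually_elim (rule assms(2))
  then show "z $ j * deriv (\<lambda>t. f (z + t *s axis j 1)) 0 = z $ j * deriv (\<lambda>t. g (z + t *s axis j 1)) 0"
    by (simp add: deriv_cong_ev)
qed

lemma radial_deriv_funpow_const:
  assumes "open S" "\<And>z. z \<in> S \<Longrightarrow> f z = c" "z \<in> S" "0 < N"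
  shows "(radial_deriv ^^ N) f z = 0"
  using assms(4,3)
proof (induction N arbitrary: z)
  case (Suc N)
  have const: "radial_deriv (\<lambda>_. a) w = 0" for a w
    by (simp add: radial_deriv_def)
  \<comment> \<open>The constant is \<open>c\<close> for \<open>N = 0\<close> and \<open>0\<close>
    for positive \<open>N\<close>.\<close>
  have "\<exists>a. \<forall>w\<in>S. (radial_deriv ^^ N) f w = a"
    using Suc.IH assms(2) by (cases "N = 0") auto
  then obtain a where "\<And>w. w \<in> S \<Longrightarrow> (radial_deriv ^^ N) f w = a" by blast
  then have "radial_deriv ((radial_deriv ^^ N) f) z = radial_deriv (\<lambda>_. a) z"
    using Suc.prems by (intro radial_deriv_cong[OF assms(1)]) auto
  then show ?case by (simp add: const)
qed simp

lemma admissible_radial_measure_sets: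
  "admissible_radial_measure \<omega> \<Longrightarrow> sets \<omega> = sets borel"
  by (auto simp: admissible_radial_measure_def)

text \<open>All points \<open>r *\<^sub>R w\<close> lie in the closed ball and the sphere has mass
  \<open>1\<close>, so the mass in question is the total mass of \<open>\<mu>\<close>. It is finite,
  and positive because \<open>\<mu>\<close> charges \<open>{1/2<..1}\<close>.\<close>

lemma admissible_radial_measure_cball:
  fixes \<omega> :: "(complex^'d) measure"
  assumes "admissible_radial_measure \<omega>"
  shows "0 < measure \<omega> (cball 0 1)" "emeasure \<omega> (cball 0 1) < \<infinity>"
proof -
  obtain \<mu> :: "real measure" where \<mu>: "sets \<mu> = sets (restrict_space borel {0..1})" "finite_measure \<mu>"
    "\<And>r. 0 < r \<and> r < 1 \<Longrightarrow> emeasure \<mu> {r<..1} > 0"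
    and \<omega>: "\<omega> = distr (\<mu> \<Otimes>\<^sub>M sphere_measure) borel (\<lambda>(r, w). r *\<^sub>R w)"
    using assms by (auto simp: admissible_radial_measure_def)
  interpret M: finite_measure \<mu> by fact
  interpret S: finite_measure "sphere_measure :: (complex^'d) measure"
    by standard (simp add: emeasure_sphere_measure_space)
  have sp: "space \<mu> = {0..1}"
    using sets_eq_imp_space_eq[OF \<mu>(1)] by (simp add: space_restrict_space)
  have meas: "(\<lambda>(r, w). r *\<^sub>R w) \<in> borel_measurable (\<mu> \<Otimes>\<^sub>M (sphere_measure :: (complex^'d) measure))"
  proof -
    have r: "(\<lambda>r. r) \<in> borel_measurable \<mu>"
      unfolding measurable_cong_sets[OF \<mu>(1) refl] by (rule measurable_restrict_space1) simp
    have w: "(\<lambda>w. w) \<in> borel_measurable (sphere_measure :: (complex^'d) measure)"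
      unfolding measurable_cong_sets[OF sets_sphere_measure refl] by (rule measurable_restrict_space1) simp
    show ?thesis
      unfolding case_prod_beta
      by (intro borel_measurable_scaleR measurable_compose[OF measurable_fst r] measurable_compose[OF measurable_snd w])
  qed
  have "emeasure \<omega> (cball 0 1) = emeasure (\<mu> \<Otimes>\<^sub>M sphere_measure)
      ((\<lambda>(r, w). r *\<^sub>R w) -` cball (0::complex^'d) 1 \<inter> space (\<mu> \<Otimes>\<^sub>M sphere_measure))"
    unfolding \<omega> by (rule emeasure_distr[OF meas]) simp
  also have "(\<lambda>(r, w). r *\<^sub>R w) -` cball (0::complex^'d) 1 \<inter> space (\<mu> \<Otimes>\<^sub>M sphere_measure)
      = space \<mu> \<times> space sphere_measure"
    by (auto simp: space_pair_measure sp)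
  also have "emeasure (\<mu> \<Otimes>\<^sub>M (sphere_measure :: (complex^'d) measure)) (space \<mu> \<times> space sphere_measure)
      = emeasure \<mu> (space \<mu>) * emeasure (sphere_measure :: (complex^'d) measure) (space sphere_measure)"
    by (rule S.emeasure_pair_measure_Times) (rule sets.top)+
  finally have eq: "emeasure \<omega> (cball 0 1) = emeasure \<mu> (space \<mu>)"
    by (simp add: emeasure_sphere_measure_space)
  then show fin: "emeasure \<omega> (cball 0 1) < \<infinity>"
    by (simp add: M.emeasure_finite less_top[symmetric])
  have "0 < emeasure \<mu> {1/2<..1}"
    using \<mu>(3)[of "1/2"] by simp
  also have "\<dots> \<le> emeasure \<mu> (space \<mu>)"
    by (rule emeasure_space)
  finally show "0 < measure \<omega> (cball 0 1)"
    using fin eq by (simp add: measure_def enn2real_positive_iff)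
qed

text \<open>Dilation by \<open>s\<close> does not change a constant, so the supremum runs over a
  nonempty constant family; the masses of the open ball and the sphere then add up to that of the
  closed ball.\<close>

lemma L2_norm_sq_const:
  fixes \<omega> :: "(complex^'d) measure"
  assumes sets: "sets \<omega> = sets borel" and g: "\<And>z. z \<in> ball 0 1 \<Longrightarrow> g z = c"
  shows "L2_norm_sq \<omega> g = ennreal ((norm c)\<^sup>2) * emeasure \<omega> (cball 0 1)"
proof -
  have "(\<integral>\<^sup>+z\<in>ball 0 1. ennreal ((norm (g z))\<^sup>2) \<partial>\<omega>) = (\<integral>\<^sup>+z\<in>ball 0 1. ennreal ((norm c)\<^sup>2) \<partial>\<omega>)"
    by (intro nn_integral_cong) (auto simp: g indicator_def)
  also have "\<dots> = ennreal ((norm c)\<^sup>2) * emeasure \<omega> (ball 0 1)"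
    using sets by (simp add: nn_integral_cmult_indicator)
  finally have 1: "(\<integral>\<^sup>+z\<in>ball 0 1. ennreal ((norm (g z))\<^sup>2) \<partial>\<omega>) = ennreal ((norm c)\<^sup>2) * emeasure \<omega> (ball 0 1)" .
  have "(\<integral>\<^sup>+z\<in>sphere 0 1. ennreal ((norm (g (s *\<^sub>R z)))\<^sup>2) \<partial>\<omega>) = ennreal ((norm c)\<^sup>2) * emeasure \<omega> (sphere 0 1)"
    if "s \<in> {0<..<1}" for s
  proof -
    have "(\<integral>\<^sup>+z\<in>sphere 0 1. ennreal ((norm (g (s *\<^sub>R z)))\<^sup>2) \<partial>\<omega>) = (\<integral>\<^sup>+z\<in>sphere 0 1. ennreal ((norm c)\<^sup>2) \<partial>\<omega>)"
      using that by (intro nn_integral_cong) (auto simp: g indicator_def)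
    also have "\<dots> = ennreal ((norm c)\<^sup>2) * emeasure \<omega> (sphere 0 1)"
      using sets by (simp add: nn_integral_cmult_indicator)
    finally show ?thesis .
  qed
  then have 2: "(SUP s\<in>{0<..<1}. \<integral>\<^sup>+z\<in>sphere 0 1. ennreal ((norm (g (s *\<^sub>R z)))\<^sup>2) \<partial>\<omega>)
      = (SUP s\<in>{0<..<1::real}. ennreal ((norm c)\<^sup>2) * emeasure \<omega> (sphere 0 1))"
    by (rule SUP_cong[OF refl])
  have "emeasure \<omega> (cball 0 1) = emeasure \<omega> (ball 0 1) + emeasure \<omega> (sphere 0 1)"
    using sets by (subst plus_emeasure) (auto intro!: arg_cong[of _ _ "emeasure \<omega>"])
  then show ?thesis
    by (simp add: L2_norm_sq_def 1 2 distrib_left del: mem_sphere)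
qed

text \<open>One formula for all \<open>N\<close>: for \<open>N = 0\<close> the norm is the integral
  norm, and for positive \<open>N\<close> the derivative term vanishes and only the value at
  \<open>0\<close> contributes.\<close>

lemma besov_norm_const:
  fixes \<omega> :: "(complex^'d) measure"
  assumes "sets \<omega> = sets borel" "\<And>z. z \<in> ball 0 1 \<Longrightarrow> g z = c"
  shows "besov_norm N \<omega> g = norm c * sqrt (measure \<omega> (cball 0 1))"
proof (cases "N = 0")
  case True
  then show ?thesis
    using L2_norm_sq_const[OF assms]
    by (simp add: besov_norm_def enn2real_mult measure_def real_sqrt_mult)
next
  case False
  then have "(radial_deriv ^^ N) g z = 0" if "z \<in> ball 0 1" for z
    using that by (intro radial_deriv_funpow_const[of "ball 0 1" g c] assms(2)) auto
  then have "L2_norm_sq \<omega> ((radial_deriv ^^ N) g) = 0"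
    using L2_norm_sq_const[OF assms(1), of "(radial_deriv ^^ N) g" 0] by simp
  then show ?thesis
    using False assms(2)[of 0] by (simp add: besov_norm_def real_sqrt_mult)
qed

lemma const_in_besov_space:
  fixes \<omega> :: "(complex^'d) measure"
  assumes "admissible_radial_measure \<omega>"
  shows "(\<lambda>_. c) \<in> besov_space N \<omega>"
proof -
  have "holomorphic_Cd (\<lambda>_. c) (ball (0::complex^'d) 1)"
    unfolding holomorphic_Cd_def by (auto intro!: exI[of _ "\<lambda>_. 0"])
  moreover have "\<exists>a. \<forall>z\<in>ball 0 1. (radial_deriv ^^ N) (\<lambda>_ :: complex^'d. c) z = a"
    using radial_deriv_funpow_const[of "ball 0 1" "\<lambda>_ :: complex^'d. c" c] by (cases "N = 0") auto
  then obtain a where "\<And>z. z \<in> ball 0 1 \<Longrightarrow> (radial_deriv ^^ N) (\<lambda>_ :: complex^'d. c) z = a"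
    by blast
  then have "L2_norm_sq \<omega> ((radial_deriv ^^ N) (\<lambda>_. c)) = ennreal ((norm a)\<^sup>2) * emeasure \<omega> (cball 0 1)"
    by (rule L2_norm_sq_const[OF admissible_radial_measure_sets[OF assms]])
  then have "L2_norm_sq \<omega> ((radial_deriv ^^ N) (\<lambda>_. c)) < \<infinity>"
    using admissible_radial_measure_cball(2)[OF assms] by (simp add: ennreal_mult_less_top)
  ultimately show ?thesis by (simp add: besov_space_def)
qed

text \<open>For every multiplier \<open>\<phi>\<close> the function
  \<open>\<phi> z * f z - 1\<close> is \<open>-1\<close> on the ball, so the constant
  \<open>1\<close> keeps a fixed positive distance from all multiples of \<open>f\<close>.\<close>

lemma zero_not_cyclic:
  assumes \<omega>: "admissible_radial_measure \<omega>" and f: "\<And>z. z \<in> ball 0 1 \<Longrightarrow> f z = 0"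
  shows "\<not> cyclic_in_besov N \<omega> f"
proof
  assume "cyclic_in_besov N \<omega> f"
  then have "(\<lambda>_. 1) \<in> generated_subspace (besov_space N \<omega>) (besov_norm N \<omega>) f"
    using const_in_besov_space[OF \<omega>] by (simp add: cyclic_in_besov_def)
  moreover have "0 < sqrt (measure \<omega> (cball 0 1))"
    using admissible_radial_measure_cball(1)[OF \<omega>] by simp
  ultimately obtain \<phi> where "besov_norm N \<omega> (\<lambda>z. \<phi> z * f z - 1) < sqrt (measure \<omega> (cball 0 1))"
    unfolding generated_subspace_def by blast
  moreover have "besov_norm N \<omega> (\<lambda>z. \<phi> z * f z - 1) = norm (- 1 :: complex) * sqrt (measure \<omega> (cball 0 1))"
    using f by (intro besov_norm_const admissible_radial_measure_sets[OF \<omega>]) simp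
  ultimately show False by simp
qed

theorem theorem6p4:
  fixes N :: nat and \<omega> :: "(complex^'d) measure" and f F :: "complex^'d \<Rightarrow> complex"
    and \<alpha> :: real
  assumes "admissible_radial_measure \<omega>"
    and "f \<in> besov_space N \<omega>"
    and "continuous_on (cball 0 1) F"
    and "\<And>z. z \<in> ball 0 1 \<Longrightarrow> F z = f z"
    and "\<alpha> > 0"
    and "capacity \<alpha> (boundary_zero_set F) > 0"
  shows "\<not> cyclic_in_besov N \<omega> f"
proof (rule zero_not_cyclic[OF assms(1)])
  fix z :: "complex^'d" assume z: "z \<in> ball 0 1"
  \<comment> \<open>The argument runs with the extension \<open>F\<close>, which carries the
    boundary values, and returns to \<open>f\<close> at the end.\<close>
  have "holomorphic_Cd F (ball 0 1)"
    using assms(2,4) by (intro holomorphic_Cd_cong[of "ball 0 1" f F]) (auto simp: besov_space_def)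
  moreover have "capacity \<alpha> (boundary_zero_set F) \<le> measure sphere_measure (boundary_zero_set F)"
    using assms(5) by (intro capacity_le_measure closed_boundary_zero_set[OF assms(3)])
      (auto simp: boundary_zero_set_def)
  then have "emeasure sphere_measure (boundary_zero_set F) \<noteq> 0"
    using assms(6) by (auto simp: measure_def)
  ultimately have "F z = 0"
    using zero_if_boundary_zero_set_nonnull[OF assms(3)] z by blast
  then show "f z = 0" using assms(4)[OF z] by simp
qed

end
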